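(* Let $\mathbb{P}$ be the set of primes, let $f \colon \mathbb{P} \to \mathbb{N}_0$ be a function with support $P = \{p \in \mathbb{P} : f(p) \neq 0\}$ such that $p \nmid f(p)$ for any $p \in P$, and let $M_f = \big\langle \frac{f(p)}{p} : p \in \mathbb{P} \big\rangle$ be the Puiseux monoid induced by $f$. Each $q \in M_f$ can be uniquely written as $$q = c_0(q) + \sum_{p \in P} c_p(q) \frac{f(p)}{p},$$ where $c_0(q) \in \mathsf{n}(M_f)$, all but finitely many terms of the coefficient sequence $(c_p(q))_{p \in P}$ equal zero, and $c_p(q) \in \{0, 1, \dots, p-1\}$ for all $p \in P$.
   Context: A Puiseux monoid is an additive submonoid of $\mathbb{Q}_{\ge 0}$, and $\langle S \rangle$ denotes the additive submonoid generated by $S$. For a Puiseux monoid $M$, $\mathsf{n}(M)$ denotes its numerator submonoid, consisting of the numerators (in lowest terms) of the elements of $M$; it equals $\mathbb{N}_0 \cap M$. Here $\mathbb{N}_0 = \{0,1,2,\dots\}$. *)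

theory Defs
  imports Complex_Main "HOL-Library.FuncSet" "HOL-Computational_Algebra.Primes"
begin

definition add_submonoid :: "'a::comm_monoid_add set \<Rightarrow> bool" where
  "add_submonoid A \<longleftrightarrow> 0 \<in> A \<and> (\<forall>x\<in>A. \<forall>y\<in>A. x + y \<in> A)"

definition submonoid_generated :: "'a::comm_monoid_add set \<Rightarrow> 'a set" where
  "submonoid_generated S = add_submonoid hull S"

definition puiseux_monoid :: "rat set \<Rightarrow> bool" where
  "puiseux_monoid M \<longleftrightarrow> add_submonoid M \<and> M \<subseteq> {0..}"

text \<open>The constant \<open>quotient_of\<close> gives a rational in lowest terms with positive denominator;
  on the non-negative rationals its first component is non-negative, so \<open>nat\<close> loses nothing.\<close>

definition rat_numerator :: "rat \<Rightarrow> nat" where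
  "rat_numerator q = nat (fst (quotient_of q))"

definition numerator_submonoid :: "rat set \<Rightarrow> nat set" where
  "numerator_submonoid M = rat_numerator ` M"

text \<open>A function from the primes to the natural numbers is represented by
  \<open>f :: nat \<Rightarrow> nat\<close>, of which only the values at primes are ever used.\<close>

definition prime_support :: "(nat \<Rightarrow> nat) \<Rightarrow> nat set" where
  "prime_support f = {p. prime p \<and> f p \<noteq> 0}"

definition induced_puiseux_monoid :: "(nat \<Rightarrow> nat) \<Rightarrow> rat set" where
  "induced_puiseux_monoid f = submonoid_generated {of_nat (f p) / of_nat p | p. prime p}"

lemma add_submonoid_generated: "add_submonoid (submonoid_generated S)"
  unfolding submonoid_generated_def by (rule hull_in) (auto simp: add_submonoid_def)

lemma puiseux_monoid_induced: "puiseux_monoid (induced_puiseux_monoid f)"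
proof -
  have "induced_puiseux_monoid f \<subseteq> {0..}"
    unfolding induced_puiseux_monoid_def submonoid_generated_def
    by (rule hull_minimal) (auto simp: add_submonoid_def)
  then show ?thesis
    by (simp add: puiseux_monoid_def induced_puiseux_monoid_def add_submonoid_generated)
qed

lemma numerator_submonoid_eq:
  assumes "puiseux_monoid M"
  shows "numerator_submonoid M = {n. of_nat n \<in> M}"
proof -
  have mult: "of_nat k * x \<in> M" if "x \<in> M" for k :: nat and x
    using assms that
    by (induction k) (auto simp: puiseux_monoid_def add_submonoid_def distrib_right)
  have "of_nat (rat_numerator q) \<in> M" if q: "q \<in> M" for q
  proof -
    obtain a b where ab: "quotient_of q = (a, b)" by fastforce
    have b: "b > 0" and qab: "q = of_int a / of_int b"
      using ab quotient_of_denom_pos quotient_of_div by blast+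
    have "q \<ge> 0" using assms q by (auto simp: puiseux_monoid_def)
    then have a: "a \<ge> 0" using b qab by (simp add: zero_le_divide_iff)
    have "of_nat (nat a) = of_nat (nat b) * q" using a b qab by simp
    then show ?thesis using mult[OF q, of "nat b"] ab by (simp add: rat_numerator_def)
  qed
  moreover have "n \<in> rat_numerator ` M" if "of_nat n \<in> M" for n
  proof
    have "quotient_of (of_nat n) = (int n, 1)"
      using quotient_of_int[of "int n"] by (simp add: Rat.of_int_def)
    then show "n = rat_numerator (of_nat n)" by (simp add: rat_numerator_def)
  qed (rule that)
  ultimately show ?thesis by (auto simp: numerator_submonoid_def)
qed

end

theory Submission
  imports Defs
begin

text \<open>Existence is carrying: if a coefficient \<open>k\<close> of \<open>f p / p\<close> is at least \<open>p\<close>, then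
  \<open>(k div p) * f p\<close> is a natural number in the monoid and can be moved into the integer part.
  For uniqueness, the difference of two representations makes an integer out of a sum of fractions
  with distinct prime denominators, so every \<open>p\<close> divides the difference of the coefficients at
  \<open>p\<close> (as \<open>p\<close> does not divide \<open>f p\<close>), which is smaller than \<open>p\<close> in absolute value.\<close>

text \<open>Multiplying the sum by the product \<open>Q\<close> of the other primes makes every term
  except the one at \<open>p\<close> an integer. Hence \<open>g p * Q / p\<close> is an integer too,
  and \<open>p\<close> must divide \<open>g p\<close> because it is coprime to
  \<open>Q\<close>.\<close>

lemma prime_dvd_numerator_of_Ints_sum:
  fixes g :: "nat \<Rightarrow> int"
  assumes fin: "finite F" and primes: "\<And>p. p \<in> F \<Longrightarrow> prime p"
    and int: "(\<Sum>p\<in>F. of_int (g p) / of_nat p :: rat) \<in> \<int>"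
    and p: "p \<in> F"
  shows "int p dvd g p"
proof -
  define Q where "Q = \<Prod>(F - {p})"
  have p0: "p > 0" using primes p prime_gt_0_nat by blast
  have "(of_int (g r) / of_nat r :: rat) * of_nat Q \<in> \<int>" if r: "r \<in> F - {p}" for r
  proof -
    have "r dvd Q" unfolding Q_def using fin r by (intro dvd_prodI) auto
    then obtain m where "Q = r * m" by blast
    moreover have "r > 0" using primes r prime_gt_0_nat by blast
    ultimately have "(of_int (g r) / of_nat r :: rat) * of_nat Q = of_int (g r * int m)" by simp
    then show ?thesis by (metis Ints_of_int)
  qed
  then have rest: "(\<Sum>r\<in>F - {p}. (of_int (g r) / of_nat r :: rat) * of_nat Q) \<in> \<int>"
    by (intro Ints_sum)
  have "(\<Sum>r\<in>F. of_int (g r) / of_nat r :: rat) * of_nat Q =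
      of_int (g p) / of_nat p * of_nat Q + (\<Sum>r\<in>F - {p}. (of_int (g r) / of_nat r) * of_nat Q)"
    unfolding sum_distrib_right by (rule sum.remove[OF fin p])
  moreover have "(\<Sum>r\<in>F. of_int (g r) / of_nat r :: rat) * of_nat Q \<in> \<int>"
    using int by (intro Ints_mult) auto
  ultimately have "(of_int (g p) / of_nat p * of_nat Q :: rat) \<in> \<int>"
    using Ints_diff[OF _ rest] by fastforce
  then obtain z where "(of_int (g p) / of_nat p * of_nat Q :: rat) = of_int z"
    by (rule Ints_cases)
  then have "(of_int (g p * int Q) :: rat) = of_int (int p * z)"
    using p0 by (simp add: divide_simps mult.commute)
  then have "int p dvd g p * int Q" unfolding of_int_eq_iff by simp
  moreover have "\<not> p dvd Q"
  proof
    assume "p dvd Q"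
    then obtain r where "r \<in> F - {p}" "p dvd r"
      using fin primes p by (auto simp: Q_def prime_dvd_prod_iff)
    then show False using primes p primes_dvd_imp_eq by blast
  qed
  ultimately show ?thesis
    using primes[OF p] by (simp add: prime_dvd_mult_iff)
qed

lemma add_submonoid_of_nat_mult:
  assumes "add_submonoid A" "x \<in> A"
  shows "of_nat k * (x :: 'a :: semiring_1) \<in> A"
  using assms by (induction k) (auto simp: add_submonoid_def distrib_right)

lemma add_submonoid_sum:
  assumes "add_submonoid A" "\<And>i. i \<in> I \<Longrightarrow> g i \<in> A"
  shows "sum g I \<in> A"
  using assms(2)
  by (induction I rule: infinite_finite_induct) (use assms(1) in \<open>auto simp: add_submonoid_def\<close>)

lemma induced_puiseux_monoid_generator:
  "prime p \<Longrightarrow> of_nat (f p) / of_nat p \<in> induced_puiseux_monoid f"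
  unfolding induced_puiseux_monoid_def submonoid_generated_def
  by (intro hull_inc) auto

lemma add_submonoid_induced: "add_submonoid (induced_puiseux_monoid f)"
  using puiseux_monoid_induced by (simp add: puiseux_monoid_def)

text \<open>The numbers of this form contain all generators and are closed under addition, so they
  contain the generated submonoid. Requiring \<open>k\<close> to vanish off \<open>F\<close> lets
  two such sums be extended to a common index set and added coefficientwise.\<close>

lemma induced_puiseux_monoid_imp_sum:
  assumes "q \<in> induced_puiseux_monoid f"
  shows "\<exists>k F. finite F \<and> F \<subseteq> prime_support f \<and> (\<forall>p. p \<notin> F \<longrightarrow> k p = 0) \<and>
           q = (\<Sum>p\<in>F. of_nat (k p) * (of_nat (f p) / of_nat p))"
    (is "?R q")
proof -
  have add: "?R (x + y)" if "?R x" "?R y" for x y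
  proof -
    obtain k F where k: "finite F" "F \<subseteq> prime_support f" "\<And>p. p \<notin> F \<Longrightarrow> k p = 0"
      "x = (\<Sum>p\<in>F. of_nat (k p) * (of_nat (f p) / of_nat p))" using \<open>?R x\<close> by blast
    obtain l G where l: "finite G" "G \<subseteq> prime_support f" "\<And>p. p \<notin> G \<Longrightarrow> l p = 0"
      "y = (\<Sum>p\<in>G. of_nat (l p) * (of_nat (f p) / of_nat p))" using \<open>?R y\<close> by blast
    have "x = (\<Sum>p\<in>F \<union> G. of_nat (k p) * (of_nat (f p) / of_nat p))"
      unfolding k(4) by (rule sum.mono_neutral_left) (use k(1,3) l(1) in auto)
    moreover have "y = (\<Sum>p\<in>F \<union> G. of_nat (l p) * (of_nat (f p) / of_nat p))"
      unfolding l(4) by (rule sum.mono_neutral_left) (use k(1) l(1,3) in auto)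
    ultimately have "x + y = (\<Sum>p\<in>F \<union> G. of_nat (k p + l p) * (of_nat (f p) / of_nat p))"
      by (simp only: of_nat_add distrib_right sum.distrib)
    then show ?thesis
      using k(1-3) l(1-3) by (intro exI[of _ "\<lambda>p. k p + l p"] exI[of _ "F \<union> G"]) auto
  qed
  have zero: "?R 0"
    by (rule exI[of _ "\<lambda>_. 0"], rule exI[of _ "{}"]) simp
  have gen: "?R (of_nat (f p) / of_nat p)" if "prime p" for p
  \<comment> \<open>A prime outside the support contributes the generator 0, which the empty sum
    represents.\<close>
  proof (cases "f p = 0")
    case True
    then show ?thesis using zero by simp
  next
    case False
    then show ?thesis using that
      by (intro exI[of _ "\<lambda>r. if r = p then 1 else 0"] exI[of _ "{p}"])
        (auto simp: prime_support_def)
  qed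
  have "induced_puiseux_monoid f \<subseteq> {q. ?R q}"
    unfolding induced_puiseux_monoid_def submonoid_generated_def
  proof (rule hull_minimal)
    show "{of_nat (f p) / of_nat p |p. prime p} \<subseteq> {q. ?R q}" using gen by blast
    show "add_submonoid {q. ?R q}"
      unfolding add_submonoid_def mem_Collect_eq Ball_def by (intro conjI allI impI zero add)
  qed
  then show ?thesis using assms by blast
qed

text \<open>One round of division with remainder at all primes suffices: each carry goes into the
  integer part and never into the coefficient at another prime.\<close>

lemma puiseux_representation_exists:
  assumes "q \<in> induced_puiseux_monoid f"
  shows "\<exists>c0 c. c0 \<in> numerator_submonoid (induced_puiseux_monoid f) \<and>
           c \<in> (\<Pi>\<^sub>E p \<in> prime_support f. {0..p - 1}) \<and>
           finite {p \<in> prime_support f. c p \<noteq> 0} \<and>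
           q = of_nat c0 + (\<Sum>p \<in> {p \<in> prime_support f. c p \<noteq> 0}. of_nat (c p) * (of_nat (f p) / of_nat p))"
proof -
  let ?M = "induced_puiseux_monoid f" and ?P = "prime_support f"
  let ?w = "\<lambda>p. of_nat (f p) / of_nat p :: rat"
  obtain k F where k: "finite F" "F \<subseteq> ?P" "\<And>p. p \<notin> F \<Longrightarrow> k p = 0"
    "q = (\<Sum>p\<in>F. of_nat (k p) * ?w p)"
    using induced_puiseux_monoid_imp_sum[OF assms] by blast
  \<comment> \<open>The remainders become the coefficients and the quotients are collected in
    \<open>c0\<close>. Restricting to \<open>?P\<close> makes \<open>c\<close> extensional, as
    \<open>\<Pi>\<^sub>E\<close> demands.\<close>
  define c where "c = (\<lambda>p\<in>?P. k p mod p)"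
  define c0 where "c0 = (\<Sum>p\<in>F. (k p div p) * f p)"
  have prime: "prime p" if "p \<in> ?P" for p using that by (simp add: prime_support_def)
  \<comment> \<open>The left side is visibly a natural number and the right side a multiple of a
    generator, so the carry is an integer that lies in the monoid.\<close>
  have carry: "of_nat ((k p div p) * f p) = of_nat (k p div p * p) * ?w p" if "p \<in> F" for p
  proof -
    have "p > 0" using prime k(2) that prime_gt_0_nat by blast
    then show ?thesis by simp
  qed
  have "of_nat c0 \<in> ?M"
    unfolding c0_def of_nat_sum
  proof (rule add_submonoid_sum[OF add_submonoid_induced])
    fix p assume p: "p \<in> F"
    then have "prime p" using k(2) prime by blast
    then show "of_nat ((k p div p) * f p) \<in> ?M"
      unfolding carry[OF p]
      by (intro add_submonoid_of_nat_mult add_submonoid_induced induced_puiseux_monoid_generator)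
  qed
  then have c0: "c0 \<in> numerator_submonoid ?M"
    by (simp add: numerator_submonoid_eq puiseux_monoid_induced)
  have c: "c \<in> (\<Pi>\<^sub>E p \<in> ?P. {0..p - 1})"
  proof (rule PiE_I)
    fix p assume "p \<in> ?P"
    then have "k p mod p < p" using prime prime_gt_0_nat by simp
    then show "c p \<in> {0..p - 1}" using \<open>p \<in> ?P\<close> by (simp add: c_def)
  qed (simp add: c_def)
  \<comment> \<open>The inclusion can be proper: \<open>c p\<close> vanishes also at those
    \<open>p\<close> in \<open>F\<close> that divide \<open>k p\<close>.\<close>
  have sub: "{p \<in> ?P. c p \<noteq> 0} \<subseteq> F" using k(3) by (force simp: c_def)
  have "q = (\<Sum>p\<in>F. of_nat ((k p div p) * f p) + of_nat (c p) * ?w p)"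
    unfolding k(4)
  proof (rule sum.cong)
    fix p assume p: "p \<in> F"
    have "of_nat (k p) * ?w p = of_nat (k p div p * p + k p mod p) * ?w p" by simp
    also have "\<dots> = of_nat (k p div p * p) * ?w p + of_nat (c p) * ?w p"
      using p k(2) by (simp only: of_nat_add distrib_right) (auto simp: c_def)
    finally show "of_nat (k p) * ?w p = of_nat ((k p div p) * f p) + of_nat (c p) * ?w p"
      using carry[OF p] by simp
  qed simp
  also have "\<dots> = of_nat c0 + (\<Sum>p\<in>F. of_nat (c p) * ?w p)"
    by (simp add: c0_def sum.distrib)
  also have "(\<Sum>p\<in>F. of_nat (c p) * ?w p) = (\<Sum>p\<in>{p \<in> ?P. c p \<noteq> 0}. of_nat (c p) * ?w p)"
    using k(1,2) sub by (intro sum.mono_neutral_right) auto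
  finally show ?thesis using c0 c finite_subset[OF sub k(1)] by blast
qed

lemma puiseux_representation_unique:
  assumes ndvd: "\<And>p. p \<in> prime_support f \<Longrightarrow> \<not> p dvd f p"
    and c: "c \<in> (\<Pi>\<^sub>E p \<in> prime_support f. {0..p - 1})" "finite {p \<in> prime_support f. c p \<noteq> 0}"
    and d: "d \<in> (\<Pi>\<^sub>E p \<in> prime_support f. {0..p - 1})" "finite {p \<in> prime_support f. d p \<noteq> 0}"
    and eq: "(of_nat a :: rat) +
          (\<Sum>p \<in> {p \<in> prime_support f. c p \<noteq> 0}. of_nat (c p) * (of_nat (f p) / of_nat p)) =
        of_nat b +
          (\<Sum>p \<in> {p \<in> prime_support f. d p \<noteq> 0}. of_nat (d p) * (of_nat (f p) / of_nat p))"
  shows "a = b \<and> c = d"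
proof -
  let ?P = "prime_support f"
  let ?w = "\<lambda>p. of_nat (f p) / of_nat p :: rat"
  \<comment> \<open>Over the union of the two supports both sums can be subtracted term by
    term.\<close>
  define F where "F = {p \<in> ?P. c p \<noteq> 0} \<union> {p \<in> ?P. d p \<noteq> 0}"
  have fin: "finite F" and sub: "F \<subseteq> ?P" using c(2) d(2) by (auto simp: F_def)
  have prime: "prime p" if "p \<in> ?P" for p using that by (simp add: prime_support_def)
  have cF: "(\<Sum>p \<in> {p \<in> ?P. c p \<noteq> 0}. of_nat (c p) * ?w p) = (\<Sum>p\<in>F. of_nat (c p) * ?w p)"
    using fin by (intro sum.mono_neutral_left) (auto simp: F_def)
  have dF: "(\<Sum>p \<in> {p \<in> ?P. d p \<noteq> 0}. of_nat (d p) * ?w p) = (\<Sum>p\<in>F. of_nat (d p) * ?w p)"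
    using fin by (intro sum.mono_neutral_left) (auto simp: F_def)
  \<comment> \<open>The difference of coefficients is taken in the integers, since subtraction of
    naturals would truncate.\<close>
  have "(\<Sum>p\<in>F. of_int ((int (c p) - int (d p)) * int (f p)) / of_nat p) =
      (\<Sum>p\<in>F. of_nat (c p) * ?w p) - (\<Sum>p\<in>F. of_nat (d p) * ?w p)"
    by (simp add: sum_subtractf[symmetric] left_diff_distrib diff_divide_distrib)
  also have "\<dots> = of_int (int b - int a)"
    using eq unfolding cF dF by (simp add: algebra_simps)
  finally have int: "(\<Sum>p\<in>F. of_int ((int (c p) - int (d p)) * int (f p)) / of_nat p :: rat) \<in> \<int>"
    by simp
  have cd: "c p = d p" if p: "p \<in> ?P" for p
  proof (cases "p \<in> F")
    case True
    have "int p dvd (int (c p) - int (d p)) * int (f p)"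
      by (rule prime_dvd_numerator_of_Ints_sum[OF fin _ int True]) (use sub prime in blast)
    then have "int p dvd int (c p) - int (d p)"
      using ndvd[OF p] prime[OF p] by (simp add: prime_dvd_mult_iff)
    \<comment> \<open>Positivity of \<open>p\<close> turns the bound \<open>p - 1\<close>, a
      truncated subtraction, into a strict bound by \<open>p\<close>.\<close>
    moreover have "c p \<in> {0..p - 1}" "d p \<in> {0..p - 1}" "p > 0"
      using c(1) d(1) p prime[OF p] prime_gt_0_nat by (auto simp: PiE_iff)
    then have "\<bar>int (c p) - int (d p)\<bar> < int p" by auto
    ultimately have "int (c p) - int (d p) = 0"
      using dvd_imp_le_int[of "int (c p) - int (d p)" "int p"] by linarith
    then show ?thesis by simp
  qed (use p in \<open>auto simp: F_def\<close>)
  \<comment> \<open>Both functions are extensional, so agreement on the support is equality; the two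
    sums then cancel in \<open>eq\<close> and leave \<open>a = b\<close>.\<close>
  have "c = d" using c(1) d(1) cd by (rule PiE_ext)
  then show ?thesis using eq by simp
qed

theorem proposition5p6:
  fixes f :: "nat \<Rightarrow> nat"
  assumes "\<And>p. p \<in> prime_support f \<Longrightarrow> \<not> p dvd f p"
  shows "\<forall>q \<in> induced_puiseux_monoid f. \<exists>!(c0, c).
           c0 \<in> numerator_submonoid (induced_puiseux_monoid f) \<and>
           c \<in> (\<Pi>\<^sub>E p \<in> prime_support f. {0..p - 1}) \<and>
           finite {p \<in> prime_support f. c p \<noteq> 0} \<and>
           q = of_nat c0 + (\<Sum>p \<in> {p \<in> prime_support f. c p \<noteq> 0}. of_nat (c p) * (of_nat (f p) / of_nat p))"
proof
  fix q assume "q \<in> induced_puiseux_monoid f"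
  then obtain c0 c where rep: "c0 \<in> numerator_submonoid (induced_puiseux_monoid f)"
    "c \<in> (\<Pi>\<^sub>E p \<in> prime_support f. {0..p - 1})"
    "finite {p \<in> prime_support f. c p \<noteq> 0}"
    "q = of_nat c0 + (\<Sum>p \<in> {p \<in> prime_support f. c p \<noteq> 0}. of_nat (c p) * (of_nat (f p) / of_nat p))"
    by (blast dest: puiseux_representation_exists)
  show "\<exists>!(c0, c).
           c0 \<in> numerator_submonoid (induced_puiseux_monoid f) \<and>
           c \<in> (\<Pi>\<^sub>E p \<in> prime_support f. {0..p - 1}) \<and>
           finite {p \<in> prime_support f. c p \<noteq> 0} \<and>
           q = of_nat c0 + (\<Sum>p \<in> {p \<in> prime_support f. c p \<noteq> 0}. of_nat (c p) * (of_nat (f p) / of_nat p))"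
  proof (rule ex1I[of _ "(c0, c)"], goal_cases)
    case 1
    show ?case unfolding prod.case by (intro conjI rep)
  next
    case (2 z)
    obtain a d where z: "z = (a, d)" by fastforce
    have zrep: "d \<in> (\<Pi>\<^sub>E p \<in> prime_support f. {0..p - 1})"
      "finite {p \<in> prime_support f. d p \<noteq> 0}"
      "q = of_nat a + (\<Sum>p \<in> {p \<in> prime_support f. d p \<noteq> 0}. of_nat (d p) * (of_nat (f p) / of_nat p))"
      using 2 unfolding z prod.case by blast+
    \<comment> \<open>Chaining the two expressions through their common value \<open>q\<close> gives
      the equation that uniqueness compares.\<close>
    have "a = c0 \<and> d = c"
      by (rule puiseux_representation_unique[OF assms zrep(1,2) rep(2,3)
            trans[OF zrep(3)[symmetric] rep(4)]])
    then show ?case by (simp add: z)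
  qed
qed

end
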